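(* Let $\delta_{B}^{\ast}=\left(1-\frac{S^{2}}{S^{2}+n\tau^{2}}\right)(X-\nu)+\nu$ be the Modified Bayes estimator. Then: (a) If $n\geq 5$, the estimator $\delta_{B}^{\ast}$ is minimax, in the sense that $R(\delta_{B}^{\ast};\nu,\tau^{2},\sigma^{2})\leq R(X)=p\sigma^{2}$ for all $\nu\in\mathbb{R}^p$, $\tau^2>0$, $\sigma^2>0$. (b) For fixed $\sigma^2>0$ and $\tau^2>0$, $$\lim_{n,p\to\infty}\frac{R(\delta_{B}^{\ast};\nu,\tau^{2},\sigma^{2})}{R(X)}=\frac{\tau^{2}}{\tau^{2}+\sigma^{2}},$$ where $n$ and $p$ tend simultaneously to infinity, with no order relation or functional relation assumed between them.
   Context: Setting: $p,n\geq 1$ are integers, $\sigma^2>0$, $\tau^2>0$, $\nu\in\mathbb{R}^p$. The random vector $\theta$ has prior distribution $N_p(\nu,\tau^2 I_p)$; conditionally on $\theta$, $X\sim N_p(\theta,\sigma^2 I_p)$; and $S^2$ is a random variable independent of $(X,\theta)$ with $S^2\sim\sigma^2\chi_n^2$ (i.e. $S^2/\sigma^2$ is central chi-square with $n$ degrees of freedom). $\sigma^2$ is unknown to the statistician, while $\nu$ and $\tau^2$ are known. For an estimator $\delta=\delta(X,S^2)$ of $\theta$, its quadratic risk given $\theta$ is $R(\delta,\theta)=E_\theta\|\delta-\theta\|^2$ (expectation over $(X,S^2)$ given $\theta$), and $R(\delta;\nu,\tau^2,\sigma^2)=E_{\theta\sim N_p(\nu,\tau^2 I_p)}[R(\delta,\theta)]=E\|\delta-\theta\|^2$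 is the risk averaged over the prior. The risk of the maximum likelihood estimator $X$ is $R(X)=p\sigma^2$. In this Bayesian setting an estimator is called minimax when its risk $R(\delta;\nu,\tau^2,\sigma^2)$ never exceeds that of the minimax estimator $X$. *)

theory Defs
  imports "HOL-Probability.Probability"
begin

text \<open>
  The dimension \<open>p\<close> has to vary inside the statement, so a vector in the Euclidean
  \<open>p\<close>-space is a function on \<open>nat\<close> of which only the values at indices below \<open>p\<close> matter.
  The parameters \<open>v\<close>, \<open>\<sigma>2\<close>, \<open>\<tau>2\<close> are variances, whereas \<^const>\<open>normal_density\<close>
  takes the standard deviation.
\<close>

definition mvnormal :: "nat \<Rightarrow> (nat \<Rightarrow> real) \<Rightarrow> real \<Rightarrow> (nat \<Rightarrow> real) measure" where
  "mvnormal p \<mu> v = Pi\<^sub>M {..<p} (\<lambda>i. density lborel (normal_density (\<mu> i) (sqrt v)))"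

definition chi_square :: "nat \<Rightarrow> real measure" where
  "chi_square n = distr (mvnormal n (\<lambda>_. 0) 1) borel (\<lambda>z. \<Sum>i<n. (z i)\<^sup>2)"

definition scaled_chi_square :: "nat \<Rightarrow> real \<Rightarrow> real measure" where
  "scaled_chi_square n \<sigma>2 = distr (chi_square n) borel (\<lambda>w. \<sigma>2 * w)"

text \<open>An estimator maps an observation of \<open>X\<close> and of \<open>S\<^sup>2\<close> to an estimate of \<open>\<theta>\<close>.\<close>

type_synonym estimator = "(nat \<Rightarrow> real) \<Rightarrow> real \<Rightarrow> (nat \<Rightarrow> real)"

definition quadratic_loss :: "nat \<Rightarrow> (nat \<Rightarrow> real) \<Rightarrow> (nat \<Rightarrow> real) \<Rightarrow> real" where
  "quadratic_loss p d \<theta> = (\<Sum>i<p. (d i - \<theta> i)\<^sup>2)"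

text \<open>
  Risks are extended nonnegative integrals, so an infinite risk is \<open>\<infinity>\<close> and not the
  value \<open>0\<close> that the Bochner integral assigns to a non-integrable function.
  The law of \<open>S\<^sup>2\<close> does not depend on \<open>\<theta>\<close> and enters as a product factor: this is the
  independence of \<open>S\<^sup>2\<close> and \<open>(X, \<theta>)\<close>.
\<close>

definition risk :: "nat \<Rightarrow> nat \<Rightarrow> real \<Rightarrow> estimator \<Rightarrow> (nat \<Rightarrow> real) \<Rightarrow> ennreal" where
  "risk p n \<sigma>2 \<delta> \<theta> =
     (\<integral>\<^sup>+ (x, s). ennreal (quadratic_loss p (\<delta> x s) \<theta>)
        \<partial>(mvnormal p \<theta> \<sigma>2 \<Otimes>\<^sub>M scaled_chi_square n \<sigma>2))"

definition bayes_risk ::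
    "nat \<Rightarrow> nat \<Rightarrow> (nat \<Rightarrow> real) \<Rightarrow> real \<Rightarrow> real \<Rightarrow> estimator \<Rightarrow> ennreal" where
  "bayes_risk p n \<nu> \<tau>2 \<sigma>2 \<delta> = (\<integral>\<^sup>+ \<theta>. risk p n \<sigma>2 \<delta> \<theta> \<partial>mvnormal p \<nu> \<tau>2)"

definition mle :: estimator where
  "mle x s = x"

definition modified_bayes :: "nat \<Rightarrow> (nat \<Rightarrow> real) \<Rightarrow> real \<Rightarrow> estimator" where
  "modified_bayes n \<nu> \<tau>2 x s = (\<lambda>i. (1 - s / (s + real n * \<tau>2)) * (x i - \<nu> i) + \<nu> i)"

end

theory Submission
  imports Defs
begin

text \<open>
  Write \<open>a = S\<^sup>2 / (S\<^sup>2 + n \<tau>2)\<close> for the random shrinkage factor. The estimation error in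
  coordinate \<open>i\<close> is \<open>(1 - a) (X\<^sub>i - \<theta>\<^sub>i) - a (\<theta>\<^sub>i - \<nu>\<^sub>i)\<close>. Given \<open>S\<^sup>2\<close>, the two summands are
  centred and uncorrelated, so each coordinate contributes \<open>(1 - a)\<^sup>2 \<sigma>2 + a\<^sup>2 \<tau>2\<close> to the Bayes
  risk, whatever \<open>\<nu>\<close> is. The case \<open>a = 0\<close> is the maximum likelihood estimator, with risk \<open>p \<sigma>2\<close>
  (\<open>bayes_risk_shrinkage_estimator\<close>, \<open>bayes_risk_mle\<close>).

  This quadratic in \<open>a\<close> has its minimum \<open>\<sigma>2 \<tau>2 / (\<sigma>2 + \<tau>2)\<close> at the Bayes shrinkage factor
  \<open>a\<^sub>0 = \<sigma>2 / (\<sigma>2 + \<tau>2)\<close>, and its excess over the minimum is \<open>(\<sigma>2 + \<tau>2) (a - a\<^sub>0)\<^sup>2\<close>. The map from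
  \<open>S\<^sup>2\<close> to \<open>a\<close> sends \<open>n \<sigma>2\<close> to \<open>a\<^sub>0\<close>, and \<open>\<bar>a - a\<^sub>0\<bar> \<le> \<bar>S\<^sup>2 - n \<sigma>2\<bar> / (n (\<sigma>2 + \<tau>2))\<close> for
  \<open>S\<^sup>2 \<ge> 0\<close> (\<open>shrinkage_factor_deviation\<close>). Since \<open>S\<^sup>2\<close> has mean \<open>n \<sigma>2\<close> and variance \<open>2 n \<sigma>2\<^sup>2\<close>,
  the risk \<open>R\<close> of the modified Bayes estimator satisfies

  \<open>p \<sigma>2 \<tau>2 / (\<sigma>2 + \<tau>2) \<le> R \<le> p \<sigma>2 (\<tau>2 + 2 \<sigma>2 / n) / (\<sigma>2 + \<tau>2)\<close>

  (\<open>bayes_risk_modified_bayes_bounds\<close>). Both claims can be read off from these two bounds: as soon as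
  \<open>2 / n \<le> 1\<close> the upper one is at most \<open>p \<sigma>2\<close>; and after division by \<open>p \<sigma>2\<close> both bounds are free
  of \<open>p\<close> and converge to \<open>\<tau>2 / (\<tau>2 + \<sigma>2)\<close> as \<open>n\<close> grows, so the limit holds however \<open>p\<close> moves.
\<close>

section \<open>Moments of the normal and the chi-square law\<close>

lemma has_bochner_integral_normal:
  assumes "v > 0" "f \<in> borel_measurable borel"
    and "has_bochner_integral lborel (\<lambda>x. normal_density \<mu> (sqrt v) x * f x) I"
  shows "has_bochner_integral (density lborel (normal_density \<mu> (sqrt v))) f (I::real)"
  using assms by (intro has_bochner_integral_density) auto

text \<open>
  One formula serves both stages of the hierarchical model. With \<open>e = 0\<close> it averages the squared error of
  one coordinate over \<open>X\<close>, where \<open>d\<close> is the bias due to shrinkage; with \<open>d = 0\<close> it averages the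
  result over \<open>\<theta>\<close>, where \<open>e\<close> is the part left by the sampling noise of \<open>X\<close>.
\<close>

lemma normal_affine_square:
  fixes v :: real
  assumes "v > 0"
  shows "has_bochner_integral (density lborel (normal_density \<mu> (sqrt v)))
           (\<lambda>x. (c * (x - \<mu>) + d)\<^sup>2 + e) (c\<^sup>2 * v + d\<^sup>2 + e)"
proof (rule has_bochner_integral_normal)
  let ?D = "normal_density \<mu> (sqrt v)"
  have s: "sqrt v > 0" using assms by simp
  have 0: "has_bochner_integral lborel (\<lambda>x. (d\<^sup>2 + e) * ?D x) ((d\<^sup>2 + e) * 1)"
    using normal_moment_even[OF s, of \<mu> 0] by (intro has_bochner_integral_mult_right) simp
  have 1: "has_bochner_integral lborel (\<lambda>x. (2 * c * d) * (?D x * (x - \<mu>))) ((2 * c * d) * 0)"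
    using normal_moment_odd[OF s, of \<mu> 0] by (intro has_bochner_integral_mult_right) simp
  have 2: "has_bochner_integral lborel (\<lambda>x. c\<^sup>2 * (?D x * (x - \<mu>)\<^sup>2)) (c\<^sup>2 * v)"
    using normal_moment_even[OF s, of \<mu> 1] assms by (intro has_bochner_integral_mult_right) simp
  have eq: "(\<lambda>x. ?D x * ((c * (x - \<mu>) + d)\<^sup>2 + e)) =
      (\<lambda>x. c\<^sup>2 * (?D x * (x - \<mu>)\<^sup>2) + (2 * c * d) * (?D x * (x - \<mu>)) + (d\<^sup>2 + e) * ?D x)"
    by (simp add: fun_eq_iff power2_eq_square algebra_simps)
  show "has_bochner_integral lborel (\<lambda>x. ?D x * ((c * (x - \<mu>) + d)\<^sup>2 + e)) (c\<^sup>2 * v + d\<^sup>2 + e)"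
    unfolding eq using has_bochner_integral_add[OF has_bochner_integral_add[OF 2 1] 0]
    by (simp add: add.assoc)
qed (use assms in auto)

lemma std_normal_square_minus_1:
  "has_bochner_integral (density lborel std_normal_density) (\<lambda>x. x\<^sup>2 - 1) 0"
  using normal_affine_square[of 1 0 1 0 "-1"] by simp

lemma std_normal_square_minus_1_square:
  "has_bochner_integral (density lborel std_normal_density) (\<lambda>x. (x\<^sup>2 - 1)\<^sup>2) 2"
proof -
  let ?D = std_normal_density
  have 4: "has_bochner_integral lborel (\<lambda>x. ?D x * x ^ 4) 3"
    using std_normal_moment_even[of 2] by (simp add: fact_numeral)
  have 2: "has_bochner_integral lborel (\<lambda>x. 2 * (?D x * x\<^sup>2)) (2 * 1)"
    using std_normal_moment_even[of 1] by (intro has_bochner_integral_mult_right) simp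
  have 0: "has_bochner_integral lborel ?D 1"
    using std_normal_moment_even[of 0] by simp
  have eq: "(\<lambda>x. ?D x * (x\<^sup>2 - 1)\<^sup>2) = (\<lambda>x. ?D x * x ^ 4 - 2 * (?D x * x\<^sup>2) + ?D x)"
    by (simp add: fun_eq_iff power2_eq_square power4_eq_xxxx algebra_simps)
  have "has_bochner_integral lborel (\<lambda>x. ?D x * (x\<^sup>2 - 1)\<^sup>2) 2"
    unfolding eq using has_bochner_integral_add[OF has_bochner_integral_diff[OF 4 2] 0] by simp
  then show ?thesis
    using has_bochner_integral_normal[of 1 "\<lambda>x. (x\<^sup>2 - 1)\<^sup>2" 0 2] by simp
qed

lemma prob_space_normal:
  "v > 0 \<Longrightarrow> prob_space (density lborel (normal_density \<mu> (sqrt v)))"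
  by (rule prob_space_normal_density) simp

lemma prob_space_mvnormal: "v > 0 \<Longrightarrow> prob_space (mvnormal p \<mu> v)"
  unfolding mvnormal_def by (intro prob_space_PiM prob_space_normal)

lemma sets_mvnormal [measurable_cong]: "sets (mvnormal p \<mu> v) = sets (Pi\<^sub>M {..<p} (\<lambda>_. borel))"
  unfolding mvnormal_def by (intro sets_PiM_cong) auto

text \<open>
  The quadratic loss is a sum over coordinates, so only the one-dimensional marginals of the normal law
  enter its expectation.
\<close>

lemma nn_integral_mvnormal_component:
  assumes "v > 0" "i < p" "f \<in> borel_measurable borel"
  shows "(\<integral>\<^sup>+x. f (x i) \<partial>mvnormal p \<mu> v) =
         (\<integral>\<^sup>+y. f y \<partial>density lborel (normal_density (\<mu> i) (sqrt v)))"
proof -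
  let ?N = "\<lambda>i. density lborel (normal_density (\<mu> i) (sqrt v))"
  have "(\<integral>\<^sup>+y. f y \<partial>?N i) = (\<integral>\<^sup>+y. f y \<partial>distr (mvnormal p \<mu> v) (?N i) (\<lambda>x. x i))"
    unfolding mvnormal_def using assms prob_space_normal
    by (subst distr_PiM_component) auto
  also have "\<dots> = (\<integral>\<^sup>+x. f (x i) \<partial>mvnormal p \<mu> v)"
    using assms by (intro nn_integral_distr) (auto simp: mvnormal_def)
  finally show ?thesis by simp
qed

lemma nn_integral_mvnormal_sum_affine_squares:
  assumes v: "v > 0" and e: "e \<ge> 0"
  shows "(\<integral>\<^sup>+x. ennreal (\<Sum>i<p. (c * (x i - \<mu> i) + d i)\<^sup>2 + e) \<partial>mvnormal p \<mu> v) =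
         ennreal (\<Sum>i<p. c\<^sup>2 * v + (d i)\<^sup>2 + e)"
proof -
  have "(\<integral>\<^sup>+x. ennreal (\<Sum>i<p. (c * (x i - \<mu> i) + d i)\<^sup>2 + e) \<partial>mvnormal p \<mu> v) =
        (\<integral>\<^sup>+x. (\<Sum>i<p. ennreal ((c * (x i - \<mu> i) + d i)\<^sup>2 + e)) \<partial>mvnormal p \<mu> v)"
    using e by (subst sum_ennreal) auto
  also have "\<dots> = (\<Sum>i<p. \<integral>\<^sup>+x. ennreal ((c * (x i - \<mu> i) + d i)\<^sup>2 + e) \<partial>mvnormal p \<mu> v)"
    by (intro nn_integral_sum) measurable
  also have "\<dots> = (\<Sum>i<p. ennreal (c\<^sup>2 * v + (d i)\<^sup>2 + e))"
  proof (intro sum.cong refl)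
    fix i assume i: "i \<in> {..<p}"
    have "(\<integral>\<^sup>+x. ennreal ((c * (x i - \<mu> i) + d i)\<^sup>2 + e) \<partial>mvnormal p \<mu> v) =
        (\<integral>\<^sup>+y. ennreal ((c * (y - \<mu> i) + d i)\<^sup>2 + e)
           \<partial>density lborel (normal_density (\<mu> i) (sqrt v)))"
      using i v by (intro nn_integral_mvnormal_component) auto
    also have "\<dots> = ennreal (c\<^sup>2 * v + (d i)\<^sup>2 + e)"
      using normal_affine_square[OF v, of "\<mu> i" c "d i" e] e
      by (subst nn_integral_eq_integral) (auto simp: has_bochner_integral_iff)
    finally show "(\<integral>\<^sup>+x. ennreal ((c * (x i - \<mu> i) + d i)\<^sup>2 + e) \<partial>mvnormal p \<mu> v) =
        ennreal (c\<^sup>2 * v + (d i)\<^sup>2 + e)" .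
  qed
  also have "\<dots> = ennreal (\<Sum>i<p. c\<^sup>2 * v + (d i)\<^sup>2 + e)"
    using e v by (intro sum_ennreal) auto
  finally show ?thesis .
qed

text \<open>
  The diagonal value is the fourth-moment computation \<open>3 - 2 + 1\<close>; off the diagonal, independence
  factors the expectation into two vanishing ones.
\<close>

lemma std_mvnormal_covariance_squares:
  assumes "i < n" "j < n"
  shows "has_bochner_integral (mvnormal n (\<lambda>_. 0) 1) (\<lambda>z. ((z i)\<^sup>2 - 1) * ((z j)\<^sup>2 - 1))
           (if i = j then 2 else 0)"
proof -
  let ?N = "density lborel std_normal_density"
  interpret N: prob_space ?N
    using prob_space_normal[of 1 0] by simp
  interpret product_sigma_finite "\<lambda>_::nat. ?N"
    by standard
  \<comment> \<open>The integrand is a product with one factor for each coordinate, most of them \<open>1\<close>, so the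
     integral over the product measure factors; for \<open>i = j\<close> both squares sit in the same factor.\<close>
  define f :: "nat \<Rightarrow> real \<Rightarrow> real"
    where "f k y = (if k = i then y\<^sup>2 - 1 else 1) * (if k = j then y\<^sup>2 - 1 else 1)" for k y
  have 1: "integrable ?N (\<lambda>x. x\<^sup>2 - 1)" "integral\<^sup>L ?N (\<lambda>x. x\<^sup>2 - 1) = 0"
    using std_normal_square_minus_1 by (auto simp: has_bochner_integral_iff)
  have 2: "integrable ?N (\<lambda>x. (x\<^sup>2 - 1) * (x\<^sup>2 - 1))" "integral\<^sup>L ?N (\<lambda>x. (x\<^sup>2 - 1) * (x\<^sup>2 - 1)) = 2"
    using std_normal_square_minus_1_square by (auto simp: has_bochner_integral_iff power2_eq_square)
  have int: "integrable ?N (f k)" for k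
    using 1 2 by (cases "k = i"; cases "k = j") (auto simp: f_def[abs_def])
  have prod: "(\<Prod>k<n. f k (z k)) = ((z i)\<^sup>2 - 1) * ((z j)\<^sup>2 - 1)" for z
    using assms by (simp add: f_def prod.distrib)
  have val: "(\<Prod>k<n. integral\<^sup>L ?N (f k)) = (if i = j then 2 else 0)"
  proof (cases "i = j")
    case True
    then have "integral\<^sup>L ?N (f k) = (if k = i then 2 else 1)" for k
      using 2 N.prob_space by (auto simp: f_def[abs_def])
    with True assms show ?thesis by simp
  next
    case False
    then have "integral\<^sup>L ?N (f i) = 0" using 1 by (simp add: f_def[abs_def])
    with False assms show ?thesis by (auto intro!: prod_zero)
  qed
  have "has_bochner_integral (Pi\<^sub>M {..<n} (\<lambda>_. ?N)) (\<lambda>z. \<Prod>k<n. f k (z k))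
          (\<Prod>k<n. integral\<^sup>L ?N (f k))"
    unfolding has_bochner_integral_iff
    by (intro conjI product_integrable_prod product_integral_prod int) auto
  then show ?thesis by (simp add: prod val mvnormal_def)
qed

text \<open>
  This is the variance of the chi-square law with \<open>n\<close> degrees of freedom. Centring each \<open>(z i)\<^sup>2\<close>
  and expanding the square gives a double sum of covariances, of which only the diagonal survives.
\<close>

lemma std_mvnormal_norm_square_variance:
  "has_bochner_integral (mvnormal n (\<lambda>_. 0) 1) (\<lambda>z. ((\<Sum>i<n. (z i)\<^sup>2) - real n)\<^sup>2) (2 * real n)"
proof -
  have eq: "((\<Sum>i<n. (z i)\<^sup>2) - real n)\<^sup>2 = (\<Sum>i<n. \<Sum>j<n. ((z i)\<^sup>2 - 1) * ((z j)\<^sup>2 - 1))"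
    for z :: "nat \<Rightarrow> real"
    by (simp add: power2_eq_square sum_product sum_subtractf flip: sum_product)
  have "has_bochner_integral (mvnormal n (\<lambda>_. 0) 1)
      (\<lambda>z. \<Sum>i<n. \<Sum>j<n. ((z i)\<^sup>2 - 1) * ((z j)\<^sup>2 - 1)) (\<Sum>i<n. \<Sum>j<n. if i = j then 2 else 0)"
    by (intro has_bochner_integral_sum std_mvnormal_covariance_squares) auto
  then show ?thesis by (simp add: eq mult.commute)
qed

lemma scaled_chi_square_eq:
  "scaled_chi_square n \<sigma>2 = distr (mvnormal n (\<lambda>_. 0) 1) borel (\<lambda>z. \<sigma>2 * (\<Sum>i<n. (z i)\<^sup>2))"
  unfolding scaled_chi_square_def chi_square_def
  by (subst distr_distr) (auto simp: comp_def)

lemma sets_scaled_chi_square [measurable_cong]: "sets (scaled_chi_square n \<sigma>2) = sets borel"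
  by (simp add: scaled_chi_square_eq)

lemma prob_space_scaled_chi_square: "prob_space (scaled_chi_square n \<sigma>2)"
  unfolding scaled_chi_square_eq
  by (intro prob_space.prob_space_distr prob_space_mvnormal) auto

lemma AE_scaled_chi_square_nonneg:
  "\<sigma>2 > 0 \<Longrightarrow> AE s in scaled_chi_square n \<sigma>2. s \<ge> 0"
  unfolding scaled_chi_square_eq by (subst AE_distr_iff) (auto intro!: AE_I2 mult_nonneg_nonneg sum_nonneg)

lemma nn_integral_scaled_chi_square_variance:
  "(\<integral>\<^sup>+s. ennreal ((s - real n * \<sigma>2)\<^sup>2) \<partial>scaled_chi_square n \<sigma>2) = ennreal (2 * real n * \<sigma>2\<^sup>2)"
proof -
  have "(\<integral>\<^sup>+s. ennreal ((s - real n * \<sigma>2)\<^sup>2) \<partial>scaled_chi_square n \<sigma>2) =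
      (\<integral>\<^sup>+z. ennreal ((\<sigma>2 * (\<Sum>i<n. (z i)\<^sup>2) - real n * \<sigma>2)\<^sup>2) \<partial>mvnormal n (\<lambda>_. 0) 1)"
    unfolding scaled_chi_square_eq by (subst nn_integral_distr) auto
  also have "\<dots> = (\<integral>\<^sup>+z. ennreal (\<sigma>2\<^sup>2 * ((\<Sum>i<n. (z i)\<^sup>2) - real n)\<^sup>2) \<partial>mvnormal n (\<lambda>_. 0) 1)"
    by (intro nn_integral_cong arg_cong[of _ _ ennreal])
       (simp add: power2_eq_square algebra_simps)
  also have "\<dots> = ennreal (\<sigma>2\<^sup>2 * (2 * real n))"
    using has_bochner_integral_mult_right[OF std_mvnormal_norm_square_variance[of n], of "\<sigma>2\<^sup>2"]
    by (subst nn_integral_eq_integral) (auto simp: has_bochner_integral_iff)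
  finally show ?thesis by (simp add: mult_ac)
qed

section \<open>Bayes risk of an estimator shrinking towards the prior mean\<close>

text \<open>
  The shrinkage factor \<open>a\<close> is an arbitrary function of \<open>S\<^sup>2\<close>, so that the maximum likelihood
  estimator (\<open>a = 0\<close>) and the modified Bayes estimator belong to the same family.
\<close>

definition shrinkage_estimator :: "(nat \<Rightarrow> real) \<Rightarrow> (real \<Rightarrow> real) \<Rightarrow> estimator" where
  "shrinkage_estimator \<nu> a x s = (\<lambda>i. (1 - a s) * (x i - \<nu> i) + \<nu> i)"

text \<open>
  Variance plus squared bias, conditionally on \<open>S\<^sup>2\<close>: the independence of \<open>X\<close> and \<open>S\<^sup>2\<close> allows
  integrating over \<open>X\<close> first, with the shrinkage factor held constant.
\<close>

lemma risk_shrinkage_estimator: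
  assumes \<sigma>2: "\<sigma>2 > 0" and [measurable]: "a \<in> borel_measurable borel"
  shows "risk p n \<sigma>2 (shrinkage_estimator \<nu> a) \<theta> =
    (\<integral>\<^sup>+s. ennreal (\<Sum>i<p. (1 - a s)\<^sup>2 * \<sigma>2 + (a s)\<^sup>2 * (\<theta> i - \<nu> i)\<^sup>2) \<partial>scaled_chi_square n \<sigma>2)"
proof -
  let ?S = "scaled_chi_square n \<sigma>2" and ?X = "mvnormal p \<theta> \<sigma>2"
  interpret S: prob_space ?S by (rule prob_space_scaled_chi_square)
  interpret X: prob_space ?X using \<sigma>2 by (rule prob_space_mvnormal)
  interpret pair_sigma_finite ?X ?S ..
  have loss: "quadratic_loss p (shrinkage_estimator \<nu> a x s) \<theta> =
      (\<Sum>i<p. ((1 - a s) * (x i - \<theta> i) + (- a s) * (\<theta> i - \<nu> i))\<^sup>2 + 0)" for x s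
    unfolding quadratic_loss_def shrinkage_estimator_def
    by (intro sum.cong refl) (simp add: algebra_simps)
  have "risk p n \<sigma>2 (shrinkage_estimator \<nu> a) \<theta> =
    (\<integral>\<^sup>+s. \<integral>\<^sup>+x. ennreal (\<Sum>i<p. ((1 - a s) * (x i - \<theta> i) + (- a s) * (\<theta> i - \<nu> i))\<^sup>2 + 0) \<partial>?X \<partial>?S)"
    unfolding risk_def loss by (subst nn_integral_snd[symmetric]) auto
  then show ?thesis
    by (simp only: nn_integral_mvnormal_sum_affine_squares[OF \<sigma>2 order.refl])
       (simp add: power_mult_distrib)
qed

text \<open>
  The prior turns each squared bias \<open>(a s)\<^sup>2 * (\<theta> i - \<nu> i)\<^sup>2\<close> into \<open>(a s)\<^sup>2 * \<tau>2\<close>, and the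
  dependence on \<open>\<nu>\<close> disappears.
\<close>

lemma bayes_risk_shrinkage_estimator:
  assumes \<sigma>2: "\<sigma>2 > 0" and \<tau>2: "\<tau>2 > 0" and [measurable]: "a \<in> borel_measurable borel"
  shows "bayes_risk p n \<nu> \<tau>2 \<sigma>2 (shrinkage_estimator \<nu> a) =
    (\<integral>\<^sup>+s. ennreal (real p * ((1 - a s)\<^sup>2 * \<sigma>2 + (a s)\<^sup>2 * \<tau>2)) \<partial>scaled_chi_square n \<sigma>2)"
proof -
  let ?S = "scaled_chi_square n \<sigma>2" and ?T = "mvnormal p \<nu> \<tau>2"
  interpret S: prob_space ?S by (rule prob_space_scaled_chi_square)
  interpret T: prob_space ?T using \<tau>2 by (rule prob_space_mvnormal)
  interpret pair_sigma_finite ?T ?S ..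
  have eq: "(1 - a s)\<^sup>2 * \<sigma>2 + (a s)\<^sup>2 * (\<theta> i - \<nu> i)\<^sup>2 =
      (a s * (\<theta> i - \<nu> i) + 0)\<^sup>2 + (1 - a s)\<^sup>2 * \<sigma>2" for s i and \<theta> :: "nat \<Rightarrow> real"
    by (simp add: power_mult_distrib)
  have "bayes_risk p n \<nu> \<tau>2 \<sigma>2 (shrinkage_estimator \<nu> a) =
      (\<integral>\<^sup>+\<theta>. \<integral>\<^sup>+s. ennreal (\<Sum>i<p. (a s * (\<theta> i - \<nu> i) + 0)\<^sup>2 + (1 - a s)\<^sup>2 * \<sigma>2) \<partial>?S \<partial>?T)"
    unfolding bayes_risk_def
    by (intro nn_integral_cong) (simp only: risk_shrinkage_estimator[OF \<sigma>2 assms(3)] eq)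
  also have "\<dots> =
      (\<integral>\<^sup>+s. \<integral>\<^sup>+\<theta>. ennreal (\<Sum>i<p. (a s * (\<theta> i - \<nu> i) + 0)\<^sup>2 + (1 - a s)\<^sup>2 * \<sigma>2) \<partial>?T \<partial>?S)"
    by (intro Fubini'[symmetric]) measurable
  also have "\<dots> = (\<integral>\<^sup>+s. ennreal (\<Sum>i<p. (a s)\<^sup>2 * \<tau>2 + 0\<^sup>2 + (1 - a s)\<^sup>2 * \<sigma>2) \<partial>?S)"
    using \<sigma>2 by (intro nn_integral_cong nn_integral_mvnormal_sum_affine_squares[OF \<tau>2]) simp
  finally show ?thesis by (simp add: algebra_simps)
qed

lemma bayes_risk_mle:
  assumes "\<sigma>2 > 0" "\<tau>2 > 0"
  shows "bayes_risk p n \<nu> \<tau>2 \<sigma>2 mle = ennreal (real p * \<sigma>2)"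
proof -
  interpret S: prob_space "scaled_chi_square n \<sigma>2" by (rule prob_space_scaled_chi_square)
  have "mle = shrinkage_estimator \<nu> (\<lambda>_. 0)"
    by (simp add: fun_eq_iff mle_def shrinkage_estimator_def)
  then show ?thesis
    using bayes_risk_shrinkage_estimator[OF assms, of "\<lambda>_. 0" p n \<nu>] S.emeasure_space_1 by simp
qed

section \<open>Bounds on the risk of the modified Bayes estimator\<close>

text \<open>
  The value \<open>\<sigma>2 / (\<sigma>2 + \<tau>2)\<close> is the shrinkage factor of the Bayes estimator for known variance,
  hence the minimizer of the left-hand side.
\<close>

lemma shrinkage_risk_complete_square:
  fixes \<sigma>2 \<tau>2 a :: real
  assumes "\<sigma>2 > 0" "\<tau>2 > 0"
  shows "(1 - a)\<^sup>2 * \<sigma>2 + a\<^sup>2 * \<tau>2 =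
         \<sigma>2 * \<tau>2 / (\<sigma>2 + \<tau>2) + (\<sigma>2 + \<tau>2) * (a - \<sigma>2 / (\<sigma>2 + \<tau>2))\<^sup>2"
proof -
  \<comment> \<open>In terms of \<open>c\<close> and \<open>k\<close> the identity is polynomial.\<close>
  define c where "c = \<sigma>2 + \<tau>2"
  define k where "k = \<sigma>2 / c"
  have "c > 0" using assms by (simp add: c_def)
  then have \<sigma>2: "\<sigma>2 = k * c" by (simp add: k_def)
  then have \<tau>2: "\<tau>2 = (1 - k) * c" by (simp add: c_def algebra_simps)
  have "(1 - a)\<^sup>2 * \<sigma>2 + a\<^sup>2 * \<tau>2 = k * \<tau>2 + c * (a - k)\<^sup>2"
    unfolding \<sigma>2 \<tau>2 by (simp add: power2_eq_square algebra_simps)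
  then show ?thesis by (simp add: k_def c_def)
qed

text \<open>
  The function \<open>s / (s + m * \<tau>2)\<close> takes the value \<open>\<sigma>2 / (\<sigma>2 + \<tau>2)\<close> at \<open>s = m * \<sigma>2\<close>. The
  difference from that value is exactly linear in \<open>s - m * \<sigma>2\<close> up to the factor
  \<open>m * \<tau>2 / (s + m * \<tau>2)\<close>, which lies in the unit interval when \<open>s\<close> is nonnegative. This reduces the
  excess risk to the second central moment of \<open>S\<^sup>2\<close>.
\<close>

lemma shrinkage_factor_deviation:
  fixes \<sigma>2 \<tau>2 s m :: real
  assumes \<sigma>2: "\<sigma>2 > 0" and \<tau>2: "\<tau>2 > 0" and m: "m > 0" and s: "s \<ge> 0"
  shows "(s / (s + m * \<tau>2) - \<sigma>2 / (\<sigma>2 + \<tau>2))\<^sup>2 \<le> ((s - m * \<sigma>2) / (m * (\<sigma>2 + \<tau>2)))\<^sup>2"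
proof -
  have pos: "s + m * \<tau>2 > 0" "\<sigma>2 + \<tau>2 > 0" using assms by (auto intro: add_nonneg_pos)
  have "s / (s + m * \<tau>2) - \<sigma>2 / (\<sigma>2 + \<tau>2) =
      \<tau>2 * (s - m * \<sigma>2) / ((s + m * \<tau>2) * (\<sigma>2 + \<tau>2))"
    using pos by (simp add: diff_frac_eq algebra_simps)
  also have "\<dots> = (m * \<tau>2 / (s + m * \<tau>2)) * ((s - m * \<sigma>2) / (m * (\<sigma>2 + \<tau>2)))"
    using m by simp
  finally have eq: "s / (s + m * \<tau>2) - \<sigma>2 / (\<sigma>2 + \<tau>2) =
      (m * \<tau>2 / (s + m * \<tau>2)) * ((s - m * \<sigma>2) / (m * (\<sigma>2 + \<tau>2)))" .
  have "(m * \<tau>2 / (s + m * \<tau>2))\<^sup>2 \<le> 1"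
    using pos s m \<tau>2 by (intro power_le_one) auto
  then show ?thesis
    unfolding eq power_mult_distrib by (intro mult_left_le_one_le) auto
qed

text \<open>
  The lower bound drops the square that measures the deviation of the shrinkage factor from the Bayes one;
  the upper bound replaces this square by a multiple of \<open>(S\<^sup>2 - n \<sigma>2)\<^sup>2\<close>, whose expectation is the
  variance of \<open>S\<^sup>2\<close>.
\<close>

lemma bayes_risk_modified_bayes_bounds:
  assumes \<sigma>2: "\<sigma>2 > 0" and \<tau>2: "\<tau>2 > 0" and n: "n \<ge> 1"
  shows "ennreal (real p * (\<sigma>2 * \<tau>2 / (\<sigma>2 + \<tau>2)))
           \<le> bayes_risk p n \<nu> \<tau>2 \<sigma>2 (modified_bayes n \<nu> \<tau>2)" (is ?lower)
    and "bayes_risk p n \<nu> \<tau>2 \<sigma>2 (modified_bayes n \<nu> \<tau>2)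
           \<le> ennreal (real p * (\<sigma>2 * (\<tau>2 + 2 * \<sigma>2 / real n) / (\<sigma>2 + \<tau>2)))" (is ?upper)
proof -
  let ?S = "scaled_chi_square n \<sigma>2"
  let ?a = "\<lambda>s. s / (s + real n * \<tau>2)"
  \<comment> \<open>\<open>L\<close> is the Bayes risk per coordinate for known \<open>\<sigma>2\<close>, and \<open>K\<close> is the factor that turns
     \<open>(S\<^sup>2 - n \<sigma>2)\<^sup>2\<close> into a bound for the excess.\<close>
  define L where "L = \<sigma>2 * \<tau>2 / (\<sigma>2 + \<tau>2)"
  define K where "K = 1 / ((real n)\<^sup>2 * (\<sigma>2 + \<tau>2))"
  have [simp]: "L \<ge> 0" "K \<ge> 0" using \<sigma>2 \<tau>2 by (auto simp: L_def K_def)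
  interpret S: prob_space ?S by (rule prob_space_scaled_chi_square)
  have "modified_bayes n \<nu> \<tau>2 = shrinkage_estimator \<nu> ?a"
    by (simp add: fun_eq_iff modified_bayes_def shrinkage_estimator_def)
  then have risk: "bayes_risk p n \<nu> \<tau>2 \<sigma>2 (modified_bayes n \<nu> \<tau>2) =
      (\<integral>\<^sup>+s. ennreal (real p * ((1 - ?a s)\<^sup>2 * \<sigma>2 + (?a s)\<^sup>2 * \<tau>2)) \<partial>?S)"
    using bayes_risk_shrinkage_estimator[OF \<sigma>2 \<tau>2, of ?a p n \<nu>] by simp
  have square: "(1 - ?a s)\<^sup>2 * \<sigma>2 + (?a s)\<^sup>2 * \<tau>2 =
      L + (\<sigma>2 + \<tau>2) * (?a s - \<sigma>2 / (\<sigma>2 + \<tau>2))\<^sup>2" for s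
    unfolding L_def by (rule shrinkage_risk_complete_square[OF \<sigma>2 \<tau>2])
  have "(\<integral>\<^sup>+s. ennreal (real p * L) \<partial>?S) \<le> bayes_risk p n \<nu> \<tau>2 \<sigma>2 (modified_bayes n \<nu> \<tau>2)"
    unfolding risk square using \<sigma>2 \<tau>2
    by (intro nn_integral_mono ennreal_leI mult_left_mono) auto
  then show ?lower
    using S.emeasure_space_1 by (simp add: L_def)
  have "bayes_risk p n \<nu> \<tau>2 \<sigma>2 (modified_bayes n \<nu> \<tau>2)
      \<le> (\<integral>\<^sup>+s. ennreal (real p * L) + ennreal (real p * K) * ennreal ((s - real n * \<sigma>2)\<^sup>2) \<partial>?S)"
    unfolding risk
  proof (rule nn_integral_mono_AE)
    show "AE s in ?S. ennreal (real p * ((1 - ?a s)\<^sup>2 * \<sigma>2 + (?a s)\<^sup>2 * \<tau>2))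
        \<le> ennreal (real p * L) + ennreal (real p * K) * ennreal ((s - real n * \<sigma>2)\<^sup>2)"
      using AE_scaled_chi_square_nonneg[OF \<sigma>2, of n]
    proof eventually_elim
      fix s :: real assume s: "s \<ge> 0"
      have "(\<sigma>2 + \<tau>2) * (?a s - \<sigma>2 / (\<sigma>2 + \<tau>2))\<^sup>2
          \<le> (\<sigma>2 + \<tau>2) * ((s - real n * \<sigma>2) / (real n * (\<sigma>2 + \<tau>2)))\<^sup>2"
        using \<sigma>2 \<tau>2 n s by (intro mult_left_mono shrinkage_factor_deviation) auto
      also have "\<dots> = K * (s - real n * \<sigma>2)\<^sup>2"
        using \<sigma>2 \<tau>2 by (simp add: K_def power2_eq_square)
      finally have "(1 - ?a s)\<^sup>2 * \<sigma>2 + (?a s)\<^sup>2 * \<tau>2 \<le> L + K * (s - real n * \<sigma>2)\<^sup>2"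
        unfolding square by simp
      then have "ennreal (real p * ((1 - ?a s)\<^sup>2 * \<sigma>2 + (?a s)\<^sup>2 * \<tau>2))
          \<le> ennreal (real p * (L + K * (s - real n * \<sigma>2)\<^sup>2))"
        by (intro ennreal_leI mult_left_mono) auto
      also have "\<dots> = ennreal (real p * L) + ennreal (real p * K) * ennreal ((s - real n * \<sigma>2)\<^sup>2)"
        by (simp add: distrib_left mult.assoc flip: ennreal_mult ennreal_plus)
      finally show "ennreal (real p * ((1 - ?a s)\<^sup>2 * \<sigma>2 + (?a s)\<^sup>2 * \<tau>2))
          \<le> ennreal (real p * L) + ennreal (real p * K) * ennreal ((s - real n * \<sigma>2)\<^sup>2)" .
    qed
  qed
  also have "\<dots> = ennreal (real p * L) + ennreal (real p * K) * ennreal (2 * real n * \<sigma>2\<^sup>2)"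
    using S.emeasure_space_1
    by (simp add: nn_integral_add nn_integral_cmult nn_integral_scaled_chi_square_variance)
  also have "\<dots> = ennreal (real p * L + real p * K * (2 * real n * \<sigma>2\<^sup>2))"
    by (simp flip: ennreal_mult ennreal_plus)
  also have "real p * L + real p * K * (2 * real n * \<sigma>2\<^sup>2) =
      real p * (\<sigma>2 * (\<tau>2 + 2 * \<sigma>2 / real n) / (\<sigma>2 + \<tau>2))"
  proof -
    have "K * (2 * real n * \<sigma>2\<^sup>2) = \<sigma>2 * (2 * \<sigma>2 / real n) / (\<sigma>2 + \<tau>2)"
      using n by (simp add: K_def power2_eq_square)
    then show ?thesis by (simp add: L_def mult.assoc add_divide_distrib distrib_left)
  qed
  finally show ?upper .
qed

lemma modified_bayes_dominates_mle:
  assumes \<sigma>2: "\<sigma>2 > 0" and \<tau>2: "\<tau>2 > 0" and n: "n \<ge> 2"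
  shows "bayes_risk p n \<nu> \<tau>2 \<sigma>2 (modified_bayes n \<nu> \<tau>2) \<le> bayes_risk p n \<nu> \<tau>2 \<sigma>2 mle"
proof -
  have "2 * \<sigma>2 / real n \<le> \<sigma>2"
    using \<sigma>2 n by (simp add: field_simps)
  then have "\<sigma>2 * (\<tau>2 + 2 * \<sigma>2 / real n) \<le> \<sigma>2 * (\<sigma>2 + \<tau>2)"
    using \<sigma>2 by (intro mult_left_mono) auto
  then have "\<sigma>2 * (\<tau>2 + 2 * \<sigma>2 / real n) / (\<sigma>2 + \<tau>2) \<le> \<sigma>2"
    using \<sigma>2 \<tau>2 by (simp add: pos_divide_le_eq)
  then have "ennreal (real p * (\<sigma>2 * (\<tau>2 + 2 * \<sigma>2 / real n) / (\<sigma>2 + \<tau>2))) \<le> ennreal (real p * \<sigma>2)"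
    by (intro ennreal_leI mult_left_mono) auto
  then show ?thesis
    using bayes_risk_modified_bayes_bounds(2)[OF \<sigma>2 \<tau>2, of n p \<nu>] n bayes_risk_mle[OF \<sigma>2 \<tau>2]
    by (metis order.trans one_le_numeral)
qed

lemma bayes_risk_ratio_bounds:
  fixes \<nu> :: "nat \<Rightarrow> real"
  assumes \<sigma>2: "\<sigma>2 > 0" and \<tau>2: "\<tau>2 > 0" and n: "n \<ge> 1" and p: "p \<ge> 1"
  defines "r \<equiv> bayes_risk p n \<nu> \<tau>2 \<sigma>2 (modified_bayes n \<nu> \<tau>2) / bayes_risk p n \<nu> \<tau>2 \<sigma>2 mle"
  shows "ennreal (\<tau>2 / (\<tau>2 + \<sigma>2)) \<le> r"
    and "r \<le> ennreal ((\<tau>2 + 2 * \<sigma>2 / real n) / (\<tau>2 + \<sigma>2))"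
proof -
  have pos: "real p * \<sigma>2 > 0" using p \<sigma>2 by simp
  have quot: "ennreal (real p * (\<sigma>2 * c / (\<sigma>2 + \<tau>2))) / ennreal (real p * \<sigma>2) =
      ennreal (c / (\<tau>2 + \<sigma>2))" if "c \<ge> 0" for c
  proof -
    have "ennreal (real p * (\<sigma>2 * c / (\<sigma>2 + \<tau>2))) / ennreal (real p * \<sigma>2) =
        ennreal (real p * (\<sigma>2 * c / (\<sigma>2 + \<tau>2)) / (real p * \<sigma>2))"
      using that pos \<sigma>2 \<tau>2 by (intro divide_ennreal) auto
    also have "real p * (\<sigma>2 * c / (\<sigma>2 + \<tau>2)) / (real p * \<sigma>2) = c / (\<tau>2 + \<sigma>2)"
      using p \<sigma>2 by (simp add: add.commute)
    finally show ?thesis .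
  qed
  show "ennreal (\<tau>2 / (\<tau>2 + \<sigma>2)) \<le> r"
    using divide_right_mono_ennreal[OF bayes_risk_modified_bayes_bounds(1)[OF \<sigma>2 \<tau>2 n],
        of p "ennreal (real p * \<sigma>2)" \<nu>] \<tau>2
    unfolding r_def bayes_risk_mle[OF \<sigma>2 \<tau>2] by (simp only: quot less_imp_le)
  have "\<tau>2 + 2 * \<sigma>2 / real n \<ge> 0" using \<sigma>2 \<tau>2 by simp
  then show "r \<le> ennreal ((\<tau>2 + 2 * \<sigma>2 / real n) / (\<tau>2 + \<sigma>2))"
    using divide_right_mono_ennreal[OF bayes_risk_modified_bayes_bounds(2)[OF \<sigma>2 \<tau>2 n],
        of p \<nu> "ennreal (real p * \<sigma>2)"]
    unfolding r_def bayes_risk_mle[OF \<sigma>2 \<tau>2] by (simp only: quot)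
qed

lemma bayes_risk_ratio_tendsto:
  assumes \<sigma>2: "\<sigma>2 > 0" and \<tau>2: "\<tau>2 > 0"
  shows "((\<lambda>(n, p). bayes_risk p n (\<nu> n p) \<tau>2 \<sigma>2 (modified_bayes n (\<nu> n p) \<tau>2)
                      / bayes_risk p n (\<nu> n p) \<tau>2 \<sigma>2 mle)
           \<longlongrightarrow> ennreal (\<tau>2 / (\<tau>2 + \<sigma>2))) (sequentially \<times>\<^sub>F sequentially)"
proof (rule tendsto_sandwich)
  have "eventually (\<lambda>n::nat. n \<ge> 1) sequentially" by (rule eventually_ge_at_top)
  then have ev: "\<forall>\<^sub>F x in sequentially \<times>\<^sub>F sequentially. fst x \<ge> (1::nat) \<and> snd x \<ge> (1::nat)"
    by (rule eventually_prodI) fact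
  show "\<forall>\<^sub>F x in sequentially \<times>\<^sub>F sequentially. ennreal (\<tau>2 / (\<tau>2 + \<sigma>2)) \<le>
     (case x of (n, p) \<Rightarrow> bayes_risk p n (\<nu> n p) \<tau>2 \<sigma>2 (modified_bayes n (\<nu> n p) \<tau>2)
                      / bayes_risk p n (\<nu> n p) \<tau>2 \<sigma>2 mle)"
    using ev by eventually_elim (auto intro: bayes_risk_ratio_bounds(1)[OF \<sigma>2 \<tau>2])
  show "\<forall>\<^sub>F x in sequentially \<times>\<^sub>F sequentially.
     (case x of (n, p) \<Rightarrow> bayes_risk p n (\<nu> n p) \<tau>2 \<sigma>2 (modified_bayes n (\<nu> n p) \<tau>2)
                      / bayes_risk p n (\<nu> n p) \<tau>2 \<sigma>2 mle)
      \<le> ennreal ((\<tau>2 + 2 * \<sigma>2 / real (fst x)) / (\<tau>2 + \<sigma>2))"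
    using ev
  proof eventually_elim
    case (elim x)
    then show ?case
      using bayes_risk_ratio_bounds(2)[OF \<sigma>2 \<tau>2, of "fst x" "snd x" "\<nu> (fst x) (snd x)"]
      by (simp only: case_prod_beta)
  qed
  have "(\<lambda>n. (\<tau>2 + 2 * \<sigma>2 / real n) / (\<tau>2 + \<sigma>2)) \<longlonglongrightarrow> (\<tau>2 + 0) / (\<tau>2 + \<sigma>2)"
    using \<sigma>2 \<tau>2 by (intro tendsto_intros lim_const_over_n) auto
  then have "(\<lambda>n. ennreal ((\<tau>2 + 2 * \<sigma>2 / real n) / (\<tau>2 + \<sigma>2))) \<longlonglongrightarrow> ennreal (\<tau>2 / (\<tau>2 + \<sigma>2))"
    by (intro tendsto_ennrealI) simp
  then show "((\<lambda>x. ennreal ((\<tau>2 + 2 * \<sigma>2 / real (fst x)) / (\<tau>2 + \<sigma>2)))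
      \<longlongrightarrow> ennreal (\<tau>2 / (\<tau>2 + \<sigma>2))) (sequentially \<times>\<^sub>F sequentially)"
    by (rule filterlim_compose[OF _ filterlim_fst])
qed simp

theorem theorem2:
  shows
    "(\<forall>(p::nat) (n::nat) (\<nu>::nat \<Rightarrow> real) (\<tau>2::real) (\<sigma>2::real).
        p \<ge> 1 \<longrightarrow> n \<ge> 5 \<longrightarrow> \<tau>2 > 0 \<longrightarrow> \<sigma>2 > 0 \<longrightarrow>
          bayes_risk p n \<nu> \<tau>2 \<sigma>2 (modified_bayes n \<nu> \<tau>2) \<le> bayes_risk p n \<nu> \<tau>2 \<sigma>2 mle \<and>
          bayes_risk p n \<nu> \<tau>2 \<sigma>2 mle = ennreal (real p * \<sigma>2)) \<and>
     (\<forall>(\<nu>::nat \<Rightarrow> nat \<Rightarrow> nat \<Rightarrow> real) (\<tau>2::real) (\<sigma>2::real).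
        \<tau>2 > 0 \<longrightarrow> \<sigma>2 > 0 \<longrightarrow>
          ((\<lambda>(n, p). bayes_risk p n (\<nu> n p) \<tau>2 \<sigma>2 (modified_bayes n (\<nu> n p) \<tau>2)
                       / bayes_risk p n (\<nu> n p) \<tau>2 \<sigma>2 mle)
             \<longlongrightarrow> ennreal (\<tau>2 / (\<tau>2 + \<sigma>2))) (sequentially \<times>\<^sub>F sequentially))"
  by (intro conjI allI impI modified_bayes_dominates_mle bayes_risk_mle bayes_risk_ratio_tendsto) auto

end
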